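(* For any graph $G$ of order $n$, $n\leqslant \chi_{\square}(G)\chi_{\square}(\overline{G})\leqslant n^2$; equivalently, $n\leqslant \chi(G^2)\chi(\overline{G}^2)\leqslant n^2$.
   Context: All graphs are finite and simple; the order of a graph is its number of vertices, and $\overline{G}$ denotes the complement of $G$. For a graph $G$, $d(u,v)$ is the length of a shortest $(u,v)$-path in $G$. A mapping $f:V(G)\to\{1,\ldots,k\}$ is a square $k$-coloring of $G$ if $f(u)\neq f(v)$ whenever $u\neq v$ and $d(u,v)\leqslant 2$. The square chromatic number $\chi_{\square}(G)$ is the minimum such $k$. The square graph $G^2$ is obtained from $G$ by adding an edge between every pair of vertices at distance 2 in $G$; thus $\chi_{\square}(G)=\chi(G^2)$, where $\chi$ is the ordinary chromatic number. Here $\overline{G}^2$ means the square of $\overline{G}$. *)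

theory Defs
  imports Graph_Theory.Pair_Digraph "HOL-Library.Extended_Nat" "HOL-Library.FuncSet"
begin

text \<open>
  Finite simple graphs are the \<^locale>\<open>pair_graph\<close>s: finite, loop-free, symmetric digraphs in
  which arcs are pairs of vertices, so an undirected edge \<open>uv\<close> is the pair of arcs
  \<open>(u,v)\<close> and \<open>(v,u)\<close>. The null graph is included.
\<close>

definition complement :: "'a pair_pre_digraph \<Rightarrow> 'a pair_pre_digraph" where
  "complement G = \<lparr> pverts = pverts G,
     parcs = {(u, v). u \<in> pverts G \<and> v \<in> pverts G \<and> u \<noteq> v \<and> (u, v) \<notin> parcs G} \<rparr>"

text \<open>A path is a list of arcs, so its \<^const>\<open>length\<close> is its number of edges; the distance is
  \<open>\<infinity>\<close> if there is no path.\<close>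

definition distance :: "'a pair_pre_digraph \<Rightarrow> 'a \<Rightarrow> 'a \<Rightarrow> enat" where
  "distance G u v = (INF p \<in> {p. pre_digraph.apath (with_proj G) u p v}. enat (length p))"

definition square_graph :: "'a pair_pre_digraph \<Rightarrow> 'a pair_pre_digraph" where
  "square_graph G = \<lparr> pverts = pverts G,
     parcs = parcs G \<union> {(u, v). u \<in> pverts G \<and> v \<in> pverts G \<and> distance G u v = 2} \<rparr>"

definition coloring :: "'a pair_pre_digraph \<Rightarrow> nat \<Rightarrow> ('a \<Rightarrow> nat) \<Rightarrow> bool" where
  "coloring G k f \<longleftrightarrow> f \<in> pverts G \<rightarrow> {1..k} \<and> (\<forall>(u, v) \<in> parcs G. f u \<noteq> f v)"

definition chromatic_number :: "'a pair_pre_digraph \<Rightarrow> nat" where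
  "chromatic_number G = (LEAST k. \<exists>f. coloring G k f)"

definition square_coloring :: "'a pair_pre_digraph \<Rightarrow> nat \<Rightarrow> ('a \<Rightarrow> nat) \<Rightarrow> bool" where
  "square_coloring G k f \<longleftrightarrow> f \<in> pverts G \<rightarrow> {1..k} \<and>
     (\<forall>u \<in> pverts G. \<forall>v \<in> pverts G. u \<noteq> v \<and> distance G u v \<le> 2 \<longrightarrow> f u \<noteq> f v)"

definition square_chromatic_number :: "'a pair_pre_digraph \<Rightarrow> nat" where
  "square_chromatic_number G = (LEAST k. \<exists>f. square_coloring G k f)"

lemma pair_graph_complement:
  assumes "pair_graph G"
  shows "pair_graph (complement G)"
proof -
  interpret pair_graph G by fact
  have "parcs (complement G) \<subseteq> pverts G \<times> pverts G"
    by (auto simp: complement_def)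
  then have "finite (parcs (complement G))"
    using finite_verts by (meson finite_SigmaI finite_subset)
  then show ?thesis
    using finite_verts
    by unfold_locales
      (auto simp: complement_def symmetric_def sym_def dest: arcs_symmetric)
qed

lemma (in pair_sym_digraph) distance_commute: "distance G u v = distance G v u"
proof -
  have "{p. apath u p v} = rev_path ` {p. apath v p u}"
    by (force simp: image_iff intro: exI[of _ "rev_path p" for p])
  moreover have "length (rev_path p) = length p" for p :: "('a \<times> 'a) awalk"
    by (induct p) auto
  ultimately show ?thesis
    by (simp add: distance_def image_image)
qed

lemma pair_graph_square_graph:
  assumes "pair_graph G"
  shows "pair_graph (square_graph G)"
proof -
  interpret pair_graph G by fact
  have "distance G u u = 0" if "u \<in> pverts G" for u
    using that unfolding distance_def zero_enat_def
    by (intro antisym INF_lower2[of "[]"]) (auto simp: apath_Nil_iff zero_enat_def[symmetric])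
  then have loopfree: "distance G u u \<noteq> 2" if "u \<in> pverts G" for u
    using that by simp
  have "parcs (square_graph G) \<subseteq> pverts G \<times> pverts G"
    by (auto simp: square_graph_def dest: wellformed')
  then have "finite (parcs (square_graph G))"
    using finite_verts by (meson finite_SigmaI finite_subset)
  then show ?thesis
    using finite_verts
    by unfold_locales
      (auto simp: square_graph_def symmetric_def sym_def loopfree distance_commute
        dest: arcs_symmetric wellformed' no_loops')
qed

end

theory Submission
  imports Defs
begin

text \<open>Adjacent vertices are at distance at most 2, so a square coloring of a graph is in particular
  a proper coloring. Any two distinct vertices are adjacent in the graph or in its complement, so a
  proper coloring of the graph paired with one of the complement is injective on vertices, which
  gives the lower bound. Coloring all vertices differently gives the upper bound.\<close>

text \<open>The arc alone is a path of length 1; it is a genuine \<open>apath\<close> because loops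
  are excluded.\<close>

lemma (in pair_graph) distance_arc_le_1:
  assumes "(u, v) \<in> parcs G"
  shows "distance G u v \<le> 1"
proof -
  have "apath u [(u, v)] v"
    using assms no_loops' by (auto simp: apath_def awalk_simps wellformed')
  then show ?thesis
    unfolding distance_def by (intro INF_lower2[of "[(u, v)]"]) (auto simp: one_enat_def)
qed

lemma square_coloring_imp_coloring:
  assumes "pair_graph G" "square_coloring G k f"
  shows "coloring G k f"
proof -
  interpret pair_graph G by fact
  have "distance G u v \<le> 2" if "(u, v) \<in> parcs G" for u v
    using distance_arc_le_1[OF that] by (rule order_trans) (simp add: one_le_numeral)
  then have "f u \<noteq> f v" if "(u, v) \<in> parcs G" for u v
    using assms(2) that wellformed'[OF that] no_loops'[OF that]
    unfolding square_coloring_def by blast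
  then show ?thesis
    using assms(2) unfolding coloring_def square_coloring_def by auto
qed

text \<open>Squaring keeps the vertices and only adds arcs, so it only adds constraints.\<close>

lemma coloring_square_graph_imp_coloring:
  "coloring (square_graph G) k f \<Longrightarrow> coloring G k f"
  by (auto simp: coloring_def square_graph_def)

text \<open>Two distinct vertices are separated by \<open>f\<close> or by \<open>g\<close>,
  according to which graph joins them, so the pairs of colors embed the vertices in a
  \<open>k\<close> by \<open>l\<close> grid.\<close>

lemma card_le_coloring_complement:
  assumes "coloring G k f" "coloring (complement G) l g"
  shows "card (pverts G) \<le> k * l"
proof -
  have "inj_on (\<lambda>v. (f v, g v)) (pverts G)"
  proof (rule inj_onI, rule ccontr)
    fix u v
    assume uv: "u \<in> pverts G" "v \<in> pverts G" "(f u, g u) = (f v, g v)" "u \<noteq> v"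
    then have "(u, v) \<in> parcs G \<or> (u, v) \<in> parcs (complement G)"
      by (simp add: complement_def)
    then show False
      using assms uv(3) by (auto simp: coloring_def)
  qed
  moreover have "(\<lambda>v. (f v, g v)) ` pverts G \<subseteq> {1..k} \<times> {1..l}"
    using assms by (auto simp: coloring_def complement_def)
  ultimately have "card (pverts G) \<le> card ({1..k} \<times> {1..l})"
    by (intro card_inj_on_le) auto
  then show ?thesis by simp
qed

text \<open>An injective coloring shows that the set under \<open>LEAST\<close> is nonempty, so the
  minimum is attained and is at most the order.\<close>

lemma
  assumes "pair_graph G"
  shows ex_coloring_chromatic_number: "\<exists>f. coloring G (chromatic_number G) f"
    and chromatic_number_le_card: "chromatic_number G \<le> card (pverts G)"
proof -
  interpret pair_graph G by fact
  \<comment> \<open>Colors start at 1, so a bijection onto this interval is a coloring; for the null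
    graph the interval is empty.\<close>
  obtain f where "bij_betw f (pverts G) {1..card (pverts G)}"
    using finite_same_card_bij[of "pverts G" "{1..card (pverts G)}"] by auto
  then have "coloring G (card (pverts G)) f"
    unfolding coloring_def
    by (auto simp: bij_betw_def dest: inj_onD wellformed' no_loops')
  then have ex: "\<exists>f. coloring G (card (pverts G)) f" by blast
  show "\<exists>f. coloring G (chromatic_number G) f"
    unfolding chromatic_number_def by (rule LeastI[of "\<lambda>k. \<exists>f. coloring G k f", OF ex])
  show "chromatic_number G \<le> card (pverts G)"
    unfolding chromatic_number_def by (rule Least_le[of "\<lambda>k. \<exists>f. coloring G k f", OF ex])
qed

text \<open>The same witness works here: it gives distinct vertices distinct colors whatever their
  distance, so finiteness of the vertex set suffices.\<close>

lemma
  assumes "finite (pverts G)"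
  shows ex_square_coloring_square_chromatic_number:
      "\<exists>f. square_coloring G (square_chromatic_number G) f"
    and square_chromatic_number_le_card: "square_chromatic_number G \<le> card (pverts G)"
proof -
  obtain f where "bij_betw f (pverts G) {1..card (pverts G)}"
    using finite_same_card_bij[of "pverts G" "{1..card (pverts G)}"] assms by auto
  then have "square_coloring G (card (pverts G)) f"
    unfolding square_coloring_def by (auto simp: bij_betw_def dest: inj_onD)
  then have ex: "\<exists>f. square_coloring G (card (pverts G)) f" by blast
  show "\<exists>f. square_coloring G (square_chromatic_number G) f"
    unfolding square_chromatic_number_def
    by (rule LeastI[of "\<lambda>k. \<exists>f. square_coloring G k f", OF ex])
  show "square_chromatic_number G \<le> card (pverts G)"
    unfolding square_chromatic_number_def
    by (rule Least_le[of "\<lambda>k. \<exists>f. square_coloring G k f", OF ex])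
qed

theorem theorem9:
  fixes G :: "'a pair_pre_digraph" and n :: nat
  assumes "pair_graph G"
    and "card (pverts G) = n"
  shows "n \<le> square_chromatic_number G * square_chromatic_number (complement G) \<and>
      square_chromatic_number G * square_chromatic_number (complement G) \<le> n\<^sup>2 \<and>
      n \<le> chromatic_number (square_graph G) * chromatic_number (square_graph (complement G)) \<and>
      chromatic_number (square_graph G) * chromatic_number (square_graph (complement G)) \<le> n\<^sup>2"
proof -
  let ?H = "complement G"
  interpret pair_graph G by fact
  have H: "pair_graph ?H"
    by (rule pair_graph_complement) fact
  have verts: "pverts ?H = pverts G" "pverts (square_graph K) = pverts K"
    for K :: "'a pair_pre_digraph"
    by (simp_all add: complement_def square_graph_def)
  \<comment> \<open>Both invariants are treated as numbers of colors of a proper coloring of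
    \<open>K\<close> itself, not of its square, so that one counting lemma gives both lower
    bounds.\<close>
  have "\<exists>f. coloring K (square_chromatic_number K) f"
    "\<exists>f. coloring K (chromatic_number (square_graph K)) f"
    "square_chromatic_number K \<le> n" "chromatic_number (square_graph K) \<le> n"
    if "K = G \<or> K = ?H" for K
  proof -
    have K: "pair_graph K" "pverts K = pverts G"
      using that H assms(1) verts(1) by auto
    show "\<exists>f. coloring K (square_chromatic_number K) f"
      using ex_square_coloring_square_chromatic_number[of K] K
        square_coloring_imp_coloring[OF K(1)] by auto
    show "\<exists>f. coloring K (chromatic_number (square_graph K)) f"
      using ex_coloring_chromatic_number[OF pair_graph_square_graph[OF K(1)]]
        coloring_square_graph_imp_coloring by blast
    show "square_chromatic_number K \<le> n"
      using square_chromatic_number_le_card[of K] K assms(2) by simp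
    show "chromatic_number (square_graph K) \<le> n"
      using chromatic_number_le_card[OF pair_graph_square_graph[OF K(1)]] K assms(2) verts(2)
      by simp
  qed
  note bounds = this[of G, simplified] this[of ?H, simplified]
  show ?thesis
    \<comment> \<open>The lower bounds come from the counting lemma, the upper ones from multiplying
      two bounds by \<open>n\<close>.\<close>
    using bounds card_le_coloring_complement[of G] assms(2)
    by (auto simp: power2_eq_square intro: mult_le_mono)
qed

end
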